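(* Let $L(\alpha)\in CE(\mu_8)$ with $\alpha=(b_{0,0},b_{0,1},b_{1,1},b_{1,2},b_{1,4},b_{1,6})$ and let $\Delta=b_{0,1}^2-4b_{0,0}b_{1,1}$. (1) If $b_{1,6}\neq0$, $b_{1,1}=0$, $b_{0,1}\neq0$, then $L(\alpha)\cong L(0,1,0,0,0,1)$. (2) If $b_{1,6}\neq0$, $b_{1,1}=b_{0,1}=0$, $b_{0,0}\neq0$, then $L(\alpha)\cong L(1,0,0,0,0,1)$. (3) If $b_{1,6}\neq0$, $b_{1,1}=b_{0,1}=b_{0,0}=0$, then $L(\alpha)\cong L(0,0,0,0,0,1)$. (4) If $b_{1,6}=0$, $b_{1,4}\neq0$, $b_{1,1}=0$, $b_{0,1}\neq0$, then $L(\alpha)\cong L(0,1,0,0,1,0)$. (5) If $b_{1,6}=0$, $b_{1,4}\neq0$, $b_{1,1}=b_{0,1}=0$, $b_{0,0}\neq0$, then $L(\alpha)\cong L(1,0,0,0,1,0)$. (6) If $b_{1,6}=0$, $b_{1,4}\neq0$, $b_{1,1}=b_{0,1}=b_{0,0}=0$, then $L(\alpha)\cong L(0,0,0,0,1,0)$. (7) If $b_{1,6}=b_{1,4}=0$, $b_{1,2}\neq0$, $b_{1,1}=0$, $b_{0,1}\neq0$, then $L(\alpha)\cong L(0,1,0,1,0,0)$. (8) If $b_{1,6}=b_{1,4}=0$, $b_{1,2}\neq0$, $b_{1,1}=b_{0,1}=0$, $b_{0,0}\neq0$, then $L(\alpha)\cong L(1,0,0,1,0,0)$. (9) If $b_{1,6}=b_{1,4}=0$,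 $b_{1,2}\neq0$, $b_{1,1}=b_{0,1}=b_{0,0}=0$, then $L(\alpha)\cong L(0,0,0,1,0,0)$. (10) If $b_{1,6}=b_{1,4}=b_{1,2}=0$, $b_{1,1}\neq0$, $\Delta\neq0$, then $L(\alpha)\cong L(1,0,1,0,0,0)$. (11) If $b_{1,6}=b_{1,4}=b_{1,2}=0$, $b_{1,1}\neq0$, $\Delta=0$, then $L(\alpha)\cong L(0,0,1,0,0,0)$. (12) If $b_{1,6}=b_{1,4}=b_{1,2}=b_{1,1}=0$, $b_{0,1}\neq0$, then $L(\alpha)\cong L(0,1,0,0,0,0)$. (13) If $b_{1,6}=b_{1,4}=b_{1,2}=b_{1,1}=b_{0,1}=0$, $b_{0,0}\neq0$, then $L(\alpha)\cong L(1,0,0,0,0,0)$. (14) If $b_{1,6}=b_{1,4}=b_{1,2}=b_{1,1}=b_{0,1}=b_{0,0}=0$, then $L(\alpha)\cong L(0,0,0,0,0,0)$.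
   Context: A Leibniz algebra over $\mathbb{C}$ is a complex vector space with a bilinear bracket satisfying $[x,[y,z]]=[[x,y],z]-[[x,z],y]$. $CE(\mu_8)$ (one-dimensional Leibniz central extensions of the 8-dimensional naturally graded filiform Lie algebra $\mu_8$) is the class of the 9-dimensional complex Leibniz algebras $L(\alpha)$, $\alpha=(b_{0,0},b_{0,1},b_{1,1},b_{1,2},b_{1,4},b_{1,6})\in\mathbb{C}^6$, with basis $e_0,\dots,e_8$ and brackets $[e_i,e_0]=e_{i+1}$ ($1\le i\le 7$), $[e_0,e_i]=-e_{i+1}$ ($2\le i\le 7$), $[e_0,e_0]=b_{0,0}e_8$, $[e_0,e_1]=-e_2+b_{0,1}e_8$, $[e_1,e_1]=b_{1,1}e_8$, $[e_1,e_2]=-[e_2,e_1]=b_{1,2}e_8$, $[e_1,e_4]=-[e_4,e_1]=b_{1,4}e_8$, $[e_2,e_3]=-[e_3,e_2]=-b_{1,4}e_8$, $[e_1,e_6]=-[e_6,e_1]=b_{1,6}e_8$, $[e_2,e_5]=-[e_5,e_2]=-b_{1,6}e_8$, $[e_3,e_4]=-[e_4,e_3]=b_{1,6}e_8$, all other brackets of basis vectors being zero. $\cong$ means isomorphic as Leibniz algebras. *)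

theory Defs
  imports "HOL-Analysis.Analysis"
begin

text \<open>The bracket satisfies the right Leibniz identity: right multiplications are derivations.\<close>

locale leibniz_algebra = vector_space scale
  for scale :: "complex \<Rightarrow> 'a::ab_group_add \<Rightarrow> 'a" +
  fixes bracket :: "'a \<Rightarrow> 'a \<Rightarrow> 'a"
  assumes bracket_add_left: "bracket (x + y) z = bracket x z + bracket y z"
    and bracket_add_right: "bracket x (y + z) = bracket x y + bracket x z"
    and bracket_scale_left: "bracket (scale c x) y = scale c (bracket x y)"
    and bracket_scale_right: "bracket x (scale c y) = scale c (bracket x y)"
    and leibniz: "bracket x (bracket y z) = bracket (bracket x y) z - bracket (bracket x z) y"

definition leibniz_isomorphic ::
    "(complex \<Rightarrow> 'a::ab_group_add \<Rightarrow> 'a) \<Rightarrow> ('a \<Rightarrow> 'a \<Rightarrow> 'a) \<Rightarrow>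
     (complex \<Rightarrow> 'b::ab_group_add \<Rightarrow> 'b) \<Rightarrow> ('b \<Rightarrow> 'b \<Rightarrow> 'b) \<Rightarrow> bool" where
  "leibniz_isomorphic scale1 bracket1 scale2 bracket2 \<longleftrightarrow>
     leibniz_algebra scale1 bracket1 \<and> leibniz_algebra scale2 bracket2 \<and>
     (\<exists>f. Vector_Spaces.linear scale1 scale2 f \<and> bij f \<and>
          (\<forall>x y. f (bracket1 x y) = bracket2 (f x) (f y)))"

text \<open>
  The underlying space of every algebra below is \<open>complex ^ 9\<close>. The index type \<open>9\<close> consists of
  the residues modulo 9, so its elements are \<open>of_nat i\<close> for \<open>i < 9\<close>, matching the numbering
  of the basis from 0 to 8.
\<close>

definition e :: "nat \<Rightarrow> complex ^ 9" where
  "e i = axis (of_nat i) 1"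

definition CE_table ::
    "complex \<Rightarrow> complex \<Rightarrow> complex \<Rightarrow> complex \<Rightarrow> complex \<Rightarrow> complex \<Rightarrow> nat \<Rightarrow> nat \<Rightarrow> complex ^ 9" where
  "CE_table b00 b01 b11 b12 b14 b16 i j =
     (if 1 \<le> i \<and> i \<le> 7 \<and> j = 0 then e (i + 1)
      else if i = 0 \<and> 2 \<le> j \<and> j \<le> 7 then - e (j + 1)
      else if (i, j) = (0, 0) then b00 *s e 8
      else if (i, j) = (0, 1) then - e 2 + b01 *s e 8
      else if (i, j) = (1, 1) then b11 *s e 8
      else if (i, j) = (1, 2) then b12 *s e 8
      else if (i, j) = (2, 1) then - (b12 *s e 8)
      else if (i, j) = (1, 4) then b14 *s e 8
      else if (i, j) = (4, 1) then - (b14 *s e 8)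
      else if (i, j) = (2, 3) then - (b14 *s e 8)
      else if (i, j) = (3, 2) then b14 *s e 8
      else if (i, j) = (1, 6) then b16 *s e 8
      else if (i, j) = (6, 1) then - (b16 *s e 8)
      else if (i, j) = (2, 5) then - (b16 *s e 8)
      else if (i, j) = (5, 2) then b16 *s e 8
      else if (i, j) = (3, 4) then b16 *s e 8
      else if (i, j) = (4, 3) then - (b16 *s e 8)
      else 0)"

text \<open>The bracket of the algebra \<open>L(\<alpha>)\<close>: the bilinear extension of the table.\<close>

definition L ::
    "complex \<Rightarrow> complex \<Rightarrow> complex \<Rightarrow> complex \<Rightarrow> complex \<Rightarrow> complex \<Rightarrow>
     complex ^ 9 \<Rightarrow> complex ^ 9 \<Rightarrow> complex ^ 9" where
  "L b00 b01 b11 b12 b14 b16 x y =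
     (\<Sum>i<9. \<Sum>j<9. (x $ of_nat i * y $ of_nat j) *s CE_table b00 b01 b11 b12 b14 b16 i j)"

abbreviation iso_CE ::
    "(complex ^ 9 \<Rightarrow> complex ^ 9 \<Rightarrow> complex ^ 9) \<Rightarrow>
     (complex ^ 9 \<Rightarrow> complex ^ 9 \<Rightarrow> complex ^ 9) \<Rightarrow> bool"  (infix "\<cong>" 50) where
  "A \<cong> B \<equiv> leibniz_isomorphic (*s) A (*s) B"

lemma less_9_iff: "i < 9 \<longleftrightarrow> i = 0 \<or> i = 1 \<or> i = 2 \<or> i = 3 \<or> i = 4 \<or> i = 5 \<or> i = 6 \<or> i = 7 \<or> i = 8" for i :: nat
  by auto

lemma e_nth: "i < 9 \<Longrightarrow> j < 9 \<Longrightarrow> e i $ of_nat j = (if i = j then 1 else 0)"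
  unfolding less_9_iff by (elim disjE) (simp_all add: e_def axis_def)

lemma forall_index_9:
  "(\<forall>k::9. P k) \<longleftrightarrow> P 0 \<and> P 1 \<and> P 2 \<and> P 3 \<and> P 4 \<and> P 5 \<and> P 6 \<and> P 7 \<and> P 8"
proof (intro iffI allI)
  fix k :: 9
  assume P: "P 0 \<and> P 1 \<and> P 2 \<and> P 3 \<and> P 4 \<and> P 5 \<and> P 6 \<and> P 7 \<and> P 8"
  obtain z where z: "k = of_int z" "0 \<le> z" "z < 9"
    by (cases k rule: bit1_cases) auto
  then have "z = 0 \<or> z = 1 \<or> z = 2 \<or> z = 3 \<or> z = 4 \<or> z = 5 \<or> z = 6 \<or> z = 7 \<or> z = 8"
    by auto
  then show "P k" using P z(1) by auto
qed auto

lemma L_basis: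
  assumes "i < 9" "j < 9"
  shows "L b00 b01 b11 b12 b14 b16 (e i) (e j) = CE_table b00 b01 b11 b12 b14 b16 i j"
proof -
  have "L b00 b01 b11 b12 b14 b16 (e i) (e j) =
    (\<Sum>k<9. \<Sum>l<9. if l = j then (if k = i then CE_table b00 b01 b11 b12 b14 b16 k l else 0) else 0)"
    unfolding L_def using assms by (intro sum.cong refl) (auto simp: e_nth)
  then show ?thesis using assms by simp
qed

lemma sum_less_9: "(\<Sum>i<(9::nat). f i) = f 0 + f 1 + f 2 + f 3 + f 4 + f 5 + f 6 + f 7 + f 8"
  for f :: "nat \<Rightarrow> 'a::comm_monoid_add"
  by (simp add: eval_nat_numeral ac_simps)

lemma L_nth:
  "L b00 b01 b11 b12 b14 b16 x y $ 0 = 0"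
  "L b00 b01 b11 b12 b14 b16 x y $ 1 = 0"
  "L b00 b01 b11 b12 b14 b16 x y $ 2 = x $ 1 * y $ 0 - x $ 0 * y $ 1"
  "L b00 b01 b11 b12 b14 b16 x y $ 3 = x $ 2 * y $ 0 - x $ 0 * y $ 2"
  "L b00 b01 b11 b12 b14 b16 x y $ 4 = x $ 3 * y $ 0 - x $ 0 * y $ 3"
  "L b00 b01 b11 b12 b14 b16 x y $ 5 = x $ 4 * y $ 0 - x $ 0 * y $ 4"
  "L b00 b01 b11 b12 b14 b16 x y $ 6 = x $ 5 * y $ 0 - x $ 0 * y $ 5"
  "L b00 b01 b11 b12 b14 b16 x y $ 7 = x $ 6 * y $ 0 - x $ 0 * y $ 6"
  "L b00 b01 b11 b12 b14 b16 x y $ 8 = x $ 7 * y $ 0 - x $ 0 * y $ 7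
     + b00 * (x $ 0 * y $ 0) + b01 * (x $ 0 * y $ 1) + b11 * (x $ 1 * y $ 1)
     + b12 * (x $ 1 * y $ 2 - x $ 2 * y $ 1)
     + b14 * (x $ 1 * y $ 4 - x $ 4 * y $ 1 - x $ 2 * y $ 3 + x $ 3 * y $ 2)
     + b16 * (x $ 1 * y $ 6 - x $ 6 * y $ 1 - x $ 2 * y $ 5 + x $ 5 * y $ 2
              + x $ 3 * y $ 4 - x $ 4 * y $ 3)"
  by (simp_all add: L_def sum_less_9 CE_table_def e_def axis_def algebra_simps)

lemma leibniz_algebra_L: "leibniz_algebra (*s) (L b00 b01 b11 b12 b14 b16)"
proof -
  interpret vector_space "(*s) :: complex \<Rightarrow> complex ^ 9 \<Rightarrow> complex ^ 9"
    by (rule vec.vector_space_axioms)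
  show ?thesis
    by unfold_locales (simp_all add: vec_eq_iff forall_index_9 L_nth algebra_simps)
qed

end

theory Submission
  imports Defs
begin

text \<open>
  Every isomorphism needed is a composition of three basis changes. The shear
  \<open>e\<^sub>0 \<mapsto> e\<^sub>0 + A e\<^sub>1\<close> acts on \<open>(b\<^bsub>0,0\<^esub>, b\<^bsub>0,1\<^esub>, b\<^bsub>1,1\<^esub>)\<close> as a substitution in the binary
  quadratic form \<open>[x, x]\<close> with discriminant \<open>\<Delta>\<close>, and fixes the other parameters. The
  substitution \<open>e\<^sub>1 \<mapsto> e\<^sub>1 + c e\<^sub>3 + d e\<^sub>5\<close> fixes that form and uses the first nonzero one of
  \<open>b\<^bsub>1,6\<^esub>\<close>, \<open>b\<^bsub>1,4\<^esub>\<close> to clear the parameters after it. The torus \<open>e\<^sub>0 \<mapsto> s e\<^sub>0\<close>,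
  \<open>e\<^sub>1 \<mapsto> t e\<^sub>1\<close> then normalises the at most two remaining parameters to 1.
\<close>

section \<open>Building and composing isomorphisms\<close>

text \<open>An injective linear endomorphism of the finite-dimensional space
  \<open>complex ^ 9\<close> is surjective, so a trivial kernel suffices for bijectivity.\<close>

lemma iso_CE_I:
  assumes lin: "Vector_Spaces.linear (*s) (*s) f"
    and ker: "\<And>x. f x = 0 \<Longrightarrow> x = 0"
    and hom: "\<And>x y. f (L b00 b01 b11 b12 b14 b16 x y) = L c00 c01 c11 c12 c14 c16 (f x) (f y)"
  shows "L b00 b01 b11 b12 b14 b16 \<cong> L c00 c01 c11 c12 c14 c16"
proof -
  have "inj f"
    using vec.linear_inj_iff_eq_0[OF lin] ker by blast
  then have "bij f"
    using vec.linear_inj_imp_surj[OF lin] by (simp add: bij_def)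
  then show ?thesis
    unfolding leibniz_isomorphic_def using lin hom leibniz_algebra_L by blast
qed

lemma iso_CE_trans [trans]: "A \<cong> C" if "A \<cong> B" "B \<cong> C"
proof -
  from that(1) obtain f where
    f: "Vector_Spaces.linear (*s) (*s) f" "bij f" "\<forall>x y. f (A x y) = B (f x) (f y)"
    unfolding leibniz_isomorphic_def by blast
  from that(2) obtain g where
    g: "Vector_Spaces.linear (*s) (*s) g" "bij g" "\<forall>x y. g (B x y) = C (g x) (g y)"
    unfolding leibniz_isomorphic_def by blast
  from f g have "Vector_Spaces.linear (*s) (*s) (g \<circ> f)" "bij (g \<circ> f)"
    "\<forall>x y. (g \<circ> f) (A x y) = C ((g \<circ> f) x) ((g \<circ> f) y)"
    by (auto intro: Vector_Spaces.linear_compose bij_comp)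
  then show ?thesis
    using that unfolding leibniz_isomorphic_def by blast
qed

section \<open>The three basis changes\<close>

text \<open>Induced by \<open>e\<^sub>0 \<mapsto> e\<^sub>0 + A e\<^sub>1\<close>; the \<open>e\<^sub>8\<close>-terms come from \<open>e\<^bsub>i+1\<^esub> = [e\<^sub>i, e\<^sub>0]\<close>.\<close>

lemma iso_CE_shear:
  "L (b00 + A * b01 + A\<^sup>2 * b11) (b01 + 2 * A * b11) b11 b12 b14 b16 \<cong> L b00 b01 b11 b12 b14 b16"
  (is "L ?c00 ?c01 _ _ _ _ \<cong> _")
proof -
  define f :: "complex ^ 9 \<Rightarrow> complex ^ 9" where
    "f x = x + (A * x $ 0) *s e 1
       + (A * (b11 * x $ 2 - b12 * x $ 3 - b14 * x $ 5 - b16 * x $ 7)) *s e 8" for x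
  have f_nth: "f x $ 0 = x $ 0" "f x $ 1 = x $ 1 + A * x $ 0" "f x $ 2 = x $ 2"
    "f x $ 3 = x $ 3" "f x $ 4 = x $ 4" "f x $ 5 = x $ 5" "f x $ 6 = x $ 6" "f x $ 7 = x $ 7"
    "f x $ 8 = x $ 8 + A * (b11 * x $ 2 - b12 * x $ 3 - b14 * x $ 5 - b16 * x $ 7)" for x
    by (simp_all add: f_def e_def axis_def)
  show ?thesis
  proof (rule iso_CE_I)
    show "Vector_Spaces.linear (*s) (*s) f"
      by unfold_locales (simp_all add: vec_eq_iff forall_index_9 f_nth algebra_simps)
    show "x = 0" if "f x = 0" for x
      using that by (auto simp: vec_eq_iff forall_index_9 f_nth)
    show "f (L ?c00 ?c01 b11 b12 b14 b16 x y) = L b00 b01 b11 b12 b14 b16 (f x) (f y)" for x y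
      by (simp add: vec_eq_iff forall_index_9 f_nth L_nth power2_eq_square algebra_simps)
  qed
qed

text \<open>Induced by \<open>e\<^sub>1 \<mapsto> e\<^sub>1 + c e\<^sub>3 + d e\<^sub>5\<close>, extended to commute with \<open>[\<cdot>, e\<^sub>0]\<close>.\<close>

lemma iso_CE_shift:
  "L b00 b01 b11 (b12 + 2 * c * b14 + c\<^sup>2 * b16 + 2 * d * b16) (b14 + 2 * c * b16) b16
     \<cong> L b00 b01 b11 b12 b14 b16"
  (is "L _ _ _ ?c12 ?c14 _ \<cong> _")
proof -
  define f :: "complex ^ 9 \<Rightarrow> complex ^ 9" where
    "f x = x + x $ 1 *s (c *s e 3 + d *s e 5) + x $ 2 *s (c *s e 4 + d *s e 6)
       + x $ 3 *s (c *s e 5 + d *s e 7) + x $ 4 *s (c *s e 6 + d *s e 8)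
       + x $ 5 *s (c *s e 7) + x $ 6 *s (c *s e 8)" for x
  have f_nth: "f x $ 0 = x $ 0" "f x $ 1 = x $ 1" "f x $ 2 = x $ 2"
    "f x $ 3 = x $ 3 + c * x $ 1" "f x $ 4 = x $ 4 + c * x $ 2"
    "f x $ 5 = x $ 5 + c * x $ 3 + d * x $ 1" "f x $ 6 = x $ 6 + c * x $ 4 + d * x $ 2"
    "f x $ 7 = x $ 7 + c * x $ 5 + d * x $ 3" "f x $ 8 = x $ 8 + c * x $ 6 + d * x $ 4" for x
    by (simp_all add: f_def e_def axis_def)
  show ?thesis
  proof (rule iso_CE_I)
    show "Vector_Spaces.linear (*s) (*s) f"
      by unfold_locales (simp_all add: vec_eq_iff forall_index_9 f_nth algebra_simps)
    show "x = 0" if "f x = 0" for x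
      using that by (auto simp: vec_eq_iff forall_index_9 f_nth)
    \<comment> \<open>The doubled terms arise in pairs: \<open>[e_1, c e_4]\<close> and
      \<open>[c e_3, e_2]\<close> each give \<open>c * b14\<close>, \<open>[e_1, d e_6]\<close> and
      \<open>[d e_5, e_2]\<close> each give \<open>d * b16\<close>. The square term is
      \<open>[c e_3, c e_4]\<close>.\<close>
    show "f (L b00 b01 b11 ?c12 ?c14 b16 x y) = L b00 b01 b11 b12 b14 b16 (f x) (f y)" for x y
      by (simp add: vec_eq_iff forall_index_9 f_nth L_nth power2_eq_square algebra_simps)
  qed
qed

text \<open>Sending \<open>e_0\<close> to \<open>s e_0\<close> and \<open>e_i\<close> to
  \<open>t s^(i-1) e_i\<close> gives \<open>e_8\<close> the weight \<open>t * s ^ 7\<close>; each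
  condition in \<open>c\<close> balances it against the weights of the two bracketed vectors, common
  factors cancelled.\<close>

lemma iso_CE_rescale:
  assumes "s \<noteq> 0" "t \<noteq> 0"
    and c: "c00 = b00 * t * s ^ 5" "c01 = b01 * s ^ 6" "c11 * t = b11 * s ^ 7"
      "c12 * t = b12 * s ^ 6" "c14 * t = b14 * s ^ 4" "c16 * t = b16 * s\<^sup>2"
  shows "L b00 b01 b11 b12 b14 b16 \<cong> L c00 c01 c11 c12 c14 c16"
proof -
  define f :: "complex ^ 9 \<Rightarrow> complex ^ 9" where
    "f x = (s * x $ 0) *s e 0 + (\<Sum>i=1..8. (t * s ^ (i - 1) * x $ of_nat i) *s e i)" for x
  have f_nth: "f x $ 0 = s * x $ 0" "f x $ 1 = t * x $ 1" "f x $ 2 = t * s * x $ 2"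
    "f x $ 3 = t * s ^ 2 * x $ 3" "f x $ 4 = t * s ^ 3 * x $ 4" "f x $ 5 = t * s ^ 4 * x $ 5"
    "f x $ 6 = t * s ^ 5 * x $ 6" "f x $ 7 = t * s ^ 6 * x $ 7" "f x $ 8 = t * s ^ 7 * x $ 8" for x
    by (simp_all add: f_def e_def axis_def sum.atLeast_Suc_atMost eval_nat_numeral)
  \<comment> \<open>Solved for the source parameters, these conditions have only powers of
    \<open>s\<close> as denominators.\<close>
  have b: "b11 = c11 * t / s ^ 7" "b12 = c12 * t / s ^ 6" "b14 = c14 * t / s ^ 4" "b16 = c16 * t / s\<^sup>2"
    using c assms(1) by simp_all
  show ?thesis
  proof (rule iso_CE_I)
    show "Vector_Spaces.linear (*s) (*s) f"
      by unfold_locales (simp_all add: vec_eq_iff forall_index_9 f_nth algebra_simps)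
    show "x = 0" if "f x = 0" for x
      using that assms(1,2) by (auto simp: vec_eq_iff forall_index_9 f_nth)
    show "f (L b00 b01 b11 b12 b14 b16 x y) = L c00 c01 c11 c12 c14 c16 (f x) (f y)" for x y
      using assms(1,2) unfolding c(1,2) b
      by (simp add: vec_eq_iff forall_index_9 f_nth L_nth field_simps eval_nat_numeral)
  qed
qed

text \<open>The complex numbers are algebraically closed: \<open>s\<close> is an \<open>n\<close>-th
  root of \<open>1 / z\<close>.\<close>

lemma normalizing_root:
  fixes z :: complex
  assumes "z \<noteq> 0" "n \<noteq> 0"
  obtains s where "s \<noteq> 0" "z * s ^ n = 1"
proof -
  obtain s where "s \<noteq> 0" "inverse z = s ^ n"
    using assms by (metis exists_complex_root_nonzero inverse_nonzero_iff_nonzero)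
  then show ?thesis using that assms(1) by (metis right_inverse)
qed

section \<open>Clearing parameters\<close>

text \<open>For \<open>b11 = 0\<close> the form is \<open>x_0 (b00 x_0 + b01 x_1)\<close>, and the
  shear makes \<open>b01 x_1\<close> of the second factor. It is applied to the normalised
  parameters, so that its left-hand side is the given algebra; the next three lemmas proceed
  likewise.\<close>

lemma iso_CE_kill_b00:
  assumes "b01 \<noteq> 0"
  shows "L b00 b01 0 b12 b14 b16 \<cong> L 0 b01 0 b12 b14 b16"
  using iso_CE_shear[of 0 "b00 / b01" b01 0 b12 b14 b16] assms by simp

text \<open>Completing the square in \<open>b00 x_0^2 + b01 x_0 x_1 + b11 x_1^2\<close> removes the
  mixed term and leaves \<open>-\<Delta> / (4 b11)\<close> at \<open>x_0^2\<close>.\<close>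

lemma iso_CE_complete_square:
  assumes "b11 \<noteq> 0"
  shows "L b00 b01 b11 b12 b14 b16 \<cong> L (- (b01\<^sup>2 - 4 * b00 * b11) / (4 * b11)) 0 b11 b12 b14 b16"
proof -
  have "- (b01\<^sup>2 - 4 * b00 * b11) / (4 * b11) + (b01 / (2 * b11))\<^sup>2 * b11 = b00"
    using assms by (simp add: field_simps power2_eq_square)
  then show ?thesis
    using iso_CE_shear[of "- (b01\<^sup>2 - 4 * b00 * b11) / (4 * b11)" "b01 / (2 * b11)" 0 b11 b12 b14 b16]
      assms by simp
qed

text \<open>The system is triangular: \<open>b14\<close> determines \<open>c\<close>, and then
  \<open>b12\<close> determines \<open>d\<close>.\<close>

lemma iso_CE_kill_b12_b14:
  assumes "b16 \<noteq> 0"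
  shows "L b00 b01 b11 b12 b14 b16 \<cong> L b00 b01 b11 0 0 b16"
proof -
  define c where "c = b14 / (2 * b16)"
  define d where "d = (b12 - c\<^sup>2 * b16) / (2 * b16)"
  have "2 * c * b16 = b14"
    using assms by (simp add: c_def)
  moreover have "c\<^sup>2 * b16 + 2 * d * b16 = b12"
    using assms by (simp add: d_def field_simps)
  ultimately show ?thesis
    using iso_CE_shift[of b00 b01 b11 0 c 0 b16 d] by simp
qed

text \<open>For \<open>b16 = 0\<close> the shift only adds \<open>2 * c * b14\<close> to
  \<open>b12\<close>.\<close>

lemma iso_CE_kill_b12:
  assumes "b14 \<noteq> 0"
  shows "L b00 b01 b11 b12 b14 0 \<cong> L b00 b01 b11 0 b14 0"
  using iso_CE_shift[of b00 b01 b11 0 "b12 / (2 * b14)" b14 0 0] assms by simp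

section \<open>Normalisation case by case\<close>

theorem proposition3p19:
  fixes b00 b01 b11 b12 b14 b16 \<Delta> :: complex
  assumes "\<Delta> = b01\<^sup>2 - 4 * b00 * b11"
  shows
   "(b16 \<noteq> 0 \<and> b11 = 0 \<and> b01 \<noteq> 0 \<longrightarrow>
        L b00 b01 b11 b12 b14 b16 \<cong> L 0 1 0 0 0 1) \<and>
    (b16 \<noteq> 0 \<and> b11 = 0 \<and> b01 = 0 \<and> b00 \<noteq> 0 \<longrightarrow>
        L b00 b01 b11 b12 b14 b16 \<cong> L 1 0 0 0 0 1) \<and>
    (b16 \<noteq> 0 \<and> b11 = 0 \<and> b01 = 0 \<and> b00 = 0 \<longrightarrow>
        L b00 b01 b11 b12 b14 b16 \<cong> L 0 0 0 0 0 1) \<and>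
    (b16 = 0 \<and> b14 \<noteq> 0 \<and> b11 = 0 \<and> b01 \<noteq> 0 \<longrightarrow>
        L b00 b01 b11 b12 b14 b16 \<cong> L 0 1 0 0 1 0) \<and>
    (b16 = 0 \<and> b14 \<noteq> 0 \<and> b11 = 0 \<and> b01 = 0 \<and> b00 \<noteq> 0 \<longrightarrow>
        L b00 b01 b11 b12 b14 b16 \<cong> L 1 0 0 0 1 0) \<and>
    (b16 = 0 \<and> b14 \<noteq> 0 \<and> b11 = 0 \<and> b01 = 0 \<and> b00 = 0 \<longrightarrow>
        L b00 b01 b11 b12 b14 b16 \<cong> L 0 0 0 0 1 0) \<and>
    (b16 = 0 \<and> b14 = 0 \<and> b12 \<noteq> 0 \<and> b11 = 0 \<and> b01 \<noteq> 0 \<longrightarrow>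
        L b00 b01 b11 b12 b14 b16 \<cong> L 0 1 0 1 0 0) \<and>
    (b16 = 0 \<and> b14 = 0 \<and> b12 \<noteq> 0 \<and> b11 = 0 \<and> b01 = 0 \<and> b00 \<noteq> 0 \<longrightarrow>
        L b00 b01 b11 b12 b14 b16 \<cong> L 1 0 0 1 0 0) \<and>
    (b16 = 0 \<and> b14 = 0 \<and> b12 \<noteq> 0 \<and> b11 = 0 \<and> b01 = 0 \<and> b00 = 0 \<longrightarrow>
        L b00 b01 b11 b12 b14 b16 \<cong> L 0 0 0 1 0 0) \<and>
    (b16 = 0 \<and> b14 = 0 \<and> b12 = 0 \<and> b11 \<noteq> 0 \<and> \<Delta> \<noteq> 0 \<longrightarrow>
        L b00 b01 b11 b12 b14 b16 \<cong> L 1 0 1 0 0 0) \<and>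
    (b16 = 0 \<and> b14 = 0 \<and> b12 = 0 \<and> b11 \<noteq> 0 \<and> \<Delta> = 0 \<longrightarrow>
        L b00 b01 b11 b12 b14 b16 \<cong> L 0 0 1 0 0 0) \<and>
    (b16 = 0 \<and> b14 = 0 \<and> b12 = 0 \<and> b11 = 0 \<and> b01 \<noteq> 0 \<longrightarrow>
        L b00 b01 b11 b12 b14 b16 \<cong> L 0 1 0 0 0 0) \<and>
    (b16 = 0 \<and> b14 = 0 \<and> b12 = 0 \<and> b11 = 0 \<and> b01 = 0 \<and> b00 \<noteq> 0 \<longrightarrow>
        L b00 b01 b11 b12 b14 b16 \<cong> L 1 0 0 0 0 0) \<and>
    (b16 = 0 \<and> b14 = 0 \<and> b12 = 0 \<and> b11 = 0 \<and> b01 = 0 \<and> b00 = 0 \<longrightarrow>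
        L b00 b01 b11 b12 b14 b16 \<cong> L 0 0 0 0 0 0)"
proof (intro conjI impI)
  assume *: "b16 \<noteq> 0 \<and> b11 = 0 \<and> b01 \<noteq> 0"
  have "b01 \<noteq> 0" using * by simp
  \<comment> \<open>The factor \<open>s ^ 6\<close> of \<open>b01\<close> is free of
    \<open>t\<close>, which leaves \<open>t\<close> to normalise \<open>b16\<close>.\<close>
  then obtain s where s: "s \<noteq> 0" "b01 * s ^ 6 = 1"
    by (rule normalizing_root[where n = 6]) simp_all
  have "L b00 b01 b11 b12 b14 b16 \<cong> L 0 b01 0 b12 b14 b16"
    using iso_CE_kill_b00 * by simp
  also have "\<dots> \<cong> L 0 b01 0 0 0 b16"
    using iso_CE_kill_b12_b14 * by simp
  also have "\<dots> \<cong> L 0 1 0 0 0 1"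
    by (rule iso_CE_rescale[where s = s and t = "b16 * s ^ 2"])
      (use * s in \<open>simp_all add: mult.assoc flip: power_add\<close>)
  finally show "L b00 b01 b11 b12 b14 b16 \<cong> L 0 1 0 0 0 1" .
next
  assume *: "b16 \<noteq> 0 \<and> b11 = 0 \<and> b01 = 0 \<and> b00 \<noteq> 0"
  \<comment> \<open>Normalising \<open>b16\<close> forces \<open>t = b16 * s ^ 2\<close>, so the
    factor \<open>t * s ^ 5\<close> of \<open>b00\<close> becomes
    \<open>b16 * s ^ 7\<close>.\<close>
  have "b00 * b16 \<noteq> 0" using * by simp
  then obtain s where s: "s \<noteq> 0" "b00 * b16 * s ^ 7 = 1"
    by (rule normalizing_root[where n = 7]) simp_all
  have "L b00 b01 b11 b12 b14 b16 \<cong> L b00 0 0 0 0 b16"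
    using iso_CE_kill_b12_b14 * by simp
  also have "\<dots> \<cong> L 1 0 0 0 0 1"
    by (rule iso_CE_rescale[where s = s and t = "b16 * s ^ 2"])
      (use * s in \<open>simp_all add: mult.assoc flip: power_add\<close>)
  finally show "L b00 b01 b11 b12 b14 b16 \<cong> L 1 0 0 0 0 1" .
next
  assume *: "b16 \<noteq> 0 \<and> b11 = 0 \<and> b01 = 0 \<and> b00 = 0"
  have "L b00 b01 b11 b12 b14 b16 \<cong> L 0 0 0 0 0 b16"
    using iso_CE_kill_b12_b14 * by simp
  also have "\<dots> \<cong> L 0 0 0 0 0 1"
    by (rule iso_CE_rescale[where s = 1 and t = b16]) (use * in simp_all)
  finally show "L b00 b01 b11 b12 b14 b16 \<cong> L 0 0 0 0 0 1" .
next
  assume *: "b16 = 0 \<and> b14 \<noteq> 0 \<and> b11 = 0 \<and> b01 \<noteq> 0"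
  have "b01 \<noteq> 0" using * by simp
  then obtain s where s: "s \<noteq> 0" "b01 * s ^ 6 = 1"
    by (rule normalizing_root[where n = 6]) simp_all
  have "L b00 b01 b11 b12 b14 b16 \<cong> L 0 b01 0 b12 b14 0"
    using iso_CE_kill_b00 * by simp
  also have "\<dots> \<cong> L 0 b01 0 0 b14 0"
    using iso_CE_kill_b12 * by simp
  also have "\<dots> \<cong> L 0 1 0 0 1 0"
    by (rule iso_CE_rescale[where s = s and t = "b14 * s ^ 4"])
      (use * s in \<open>simp_all add: mult.assoc flip: power_add\<close>)
  finally show "L b00 b01 b11 b12 b14 b16 \<cong> L 0 1 0 0 1 0" .
next
  assume *: "b16 = 0 \<and> b14 \<noteq> 0 \<and> b11 = 0 \<and> b01 = 0 \<and> b00 \<noteq> 0"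
  \<comment> \<open>Here \<open>t = b14 * s ^ 4\<close>, hence the exponent
    \<open>9 = 4 + 5\<close>.\<close>
  have "b00 * b14 \<noteq> 0" using * by simp
  then obtain s where s: "s \<noteq> 0" "b00 * b14 * s ^ 9 = 1"
    by (rule normalizing_root[where n = 9]) simp_all
  have "L b00 b01 b11 b12 b14 b16 \<cong> L b00 0 0 0 b14 0"
    using iso_CE_kill_b12 * by simp
  also have "\<dots> \<cong> L 1 0 0 0 1 0"
    by (rule iso_CE_rescale[where s = s and t = "b14 * s ^ 4"])
      (use * s in \<open>simp_all add: mult.assoc flip: power_add\<close>)
  finally show "L b00 b01 b11 b12 b14 b16 \<cong> L 1 0 0 0 1 0" .
next
  assume *: "b16 = 0 \<and> b14 \<noteq> 0 \<and> b11 = 0 \<and> b01 = 0 \<and> b00 = 0"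
  have "L b00 b01 b11 b12 b14 b16 \<cong> L 0 0 0 0 b14 0"
    using iso_CE_kill_b12 * by simp
  also have "\<dots> \<cong> L 0 0 0 0 1 0"
    by (rule iso_CE_rescale[where s = 1 and t = b14]) (use * in simp_all)
  finally show "L b00 b01 b11 b12 b14 b16 \<cong> L 0 0 0 0 1 0" .
next
  assume *: "b16 = 0 \<and> b14 = 0 \<and> b12 \<noteq> 0 \<and> b11 = 0 \<and> b01 \<noteq> 0"
  have "b01 \<noteq> 0" using * by simp
  then obtain s where s: "s \<noteq> 0" "b01 * s ^ 6 = 1"
    by (rule normalizing_root[where n = 6]) simp_all
  have "L b00 b01 b11 b12 b14 b16 \<cong> L 0 b01 0 b12 0 0"
    using iso_CE_kill_b00 * by simp
  also have "\<dots> \<cong> L 0 1 0 1 0 0"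
    by (rule iso_CE_rescale[where s = s and t = "b12 * s ^ 6"])
      (use * s in \<open>simp_all add: mult.assoc flip: power_add\<close>)
  finally show "L b00 b01 b11 b12 b14 b16 \<cong> L 0 1 0 1 0 0" .
next
  assume *: "b16 = 0 \<and> b14 = 0 \<and> b12 \<noteq> 0 \<and> b11 = 0 \<and> b01 = 0 \<and> b00 \<noteq> 0"
  \<comment> \<open>Here \<open>t = b12 * s ^ 6\<close>, hence the exponent
    \<open>11 = 6 + 5\<close>.\<close>
  have "b00 * b12 \<noteq> 0" using * by simp
  then obtain s where s: "s \<noteq> 0" "b00 * b12 * s ^ 11 = 1"
    by (rule normalizing_root[where n = 11]) simp_all
  have "L b00 0 0 b12 0 0 \<cong> L 1 0 0 1 0 0"
    by (rule iso_CE_rescale[where s = s and t = "b12 * s ^ 6"])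
      (use * s in \<open>simp_all add: mult.assoc flip: power_add\<close>)
  then show "L b00 b01 b11 b12 b14 b16 \<cong> L 1 0 0 1 0 0" using * by simp
next
  assume *: "b16 = 0 \<and> b14 = 0 \<and> b12 \<noteq> 0 \<and> b11 = 0 \<and> b01 = 0 \<and> b00 = 0"
  have "L 0 0 0 b12 0 0 \<cong> L 0 0 0 1 0 0"
    by (rule iso_CE_rescale[where s = 1 and t = b12]) (use * in simp_all)
  then show "L b00 b01 b11 b12 b14 b16 \<cong> L 0 0 0 1 0 0" using * by simp
next
  assume *: "b16 = 0 \<and> b14 = 0 \<and> b12 = 0 \<and> b11 \<noteq> 0 \<and> \<Delta> \<noteq> 0"
  \<comment> \<open>The coefficient left after completing the square; \<open>t = b11 * s ^ 7\<close>
    normalises \<open>b11\<close> and multiplies \<open>?q\<close> by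
    \<open>b11 * s ^ 12\<close>.\<close>
  let ?q = "- \<Delta> / (4 * b11)"
  have "?q * b11 \<noteq> 0" using * by simp
  then obtain s where s: "s \<noteq> 0" "?q * b11 * s ^ 12 = 1"
    by (rule normalizing_root[where n = 12]) simp_all
  have "L b00 b01 b11 b12 b14 b16 \<cong> L ?q 0 b11 0 0 0"
    using iso_CE_complete_square[of b11 b00 b01 b12 b14 b16] * assms by simp
  also have "\<dots> \<cong> L 1 0 1 0 0 0"
    by (rule iso_CE_rescale[where s = s and t = "b11 * s ^ 7"])
      (use * s in \<open>simp_all add: mult.assoc flip: power_add\<close>)
  finally show "L b00 b01 b11 b12 b14 b16 \<cong> L 1 0 1 0 0 0" .
next
  assume *: "b16 = 0 \<and> b14 = 0 \<and> b12 = 0 \<and> b11 \<noteq> 0 \<and> \<Delta> = 0"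
  have "L b00 b01 b11 b12 b14 b16 \<cong> L 0 0 b11 0 0 0"
    using iso_CE_complete_square[of b11 b00 b01 b12 b14 b16] * assms by simp
  also have "\<dots> \<cong> L 0 0 1 0 0 0"
    by (rule iso_CE_rescale[where s = 1 and t = b11]) (use * in simp_all)
  finally show "L b00 b01 b11 b12 b14 b16 \<cong> L 0 0 1 0 0 0" .
next
  assume *: "b16 = 0 \<and> b14 = 0 \<and> b12 = 0 \<and> b11 = 0 \<and> b01 \<noteq> 0"
  have "b01 \<noteq> 0" using * by simp
  then obtain s where s: "s \<noteq> 0" "b01 * s ^ 6 = 1"
    by (rule normalizing_root[where n = 6]) simp_all
  have "L b00 b01 b11 b12 b14 b16 \<cong> L 0 b01 0 0 0 0"
    using iso_CE_kill_b00 * by simp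
  also have "\<dots> \<cong> L 0 1 0 0 0 0"
    by (rule iso_CE_rescale[where s = s and t = 1])
      (use * s in \<open>simp_all add: mult.assoc flip: power_add\<close>)
  finally show "L b00 b01 b11 b12 b14 b16 \<cong> L 0 1 0 0 0 0" .
next
  assume *: "b16 = 0 \<and> b14 = 0 \<and> b12 = 0 \<and> b11 = 0 \<and> b01 = 0 \<and> b00 \<noteq> 0"
  have "b00 \<noteq> 0" using * by simp
  then obtain s where s: "s \<noteq> 0" "b00 * s ^ 5 = 1"
    by (rule normalizing_root[where n = 5]) simp_all
  have "L b00 0 0 0 0 0 \<cong> L 1 0 0 0 0 0"
    by (rule iso_CE_rescale[where s = s and t = 1])
      (use * s in \<open>simp_all add: mult.assoc flip: power_add\<close>)
  then show "L b00 b01 b11 b12 b14 b16 \<cong> L 1 0 0 0 0 0" using * by simp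
next
  assume *: "b16 = 0 \<and> b14 = 0 \<and> b12 = 0 \<and> b11 = 0 \<and> b01 = 0 \<and> b00 = 0"
  have "L 0 0 0 0 0 0 \<cong> L 0 0 0 0 0 0"
    \<comment> \<open>Reflexivity: the rescaling is the identity map.\<close>
    by (rule iso_CE_rescale[where s = 1 and t = 1]) simp_all
  then show "L b00 b01 b11 b12 b14 b16 \<cong> L 0 0 0 0 0 0" using * by simp
qed

end
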